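(* Let $r \ge 2$, $k\ge1$ and $n\ge 2rk$ be integers and let $A\subseteq[n]$ with $|A| \le b(r)\cdot (k-1)$. Then $$\chi(\mathrm{KG}^r_A(n,k)) = \left\lceil \frac{n - \max\{r(k-1),|A|\}}{r-1}\right\rceil.$$
   Context: For an integer $r\ge2$ with prime factorization $r=2^{\alpha_0}p_1^{\alpha_1}\cdots p_t^{\alpha_t}$ ($p_i$ pairwise distinct odd primes, $\alpha_i\ge0$), $b(r)=2^{\alpha_0}(p_1-1)^{\alpha_1}\cdots(p_t-1)^{\alpha_t}$. For a hypergraph $H$, an $m$-coloring is a map from the vertices to $[m]$ such that no hyperedge is monochromatic; $\chi(H)$ is the least such $m$. $\mathrm{KG}^r(n,k)$ is the hypergraph on the $k$-subsets of $[n]$ whose hyperedges are collections of $r$ pairwise disjoint $k$-subsets. For $A\subseteq[n]$, $\mathrm{KG}^r_A(n,k)$ is the subhypergraph of $\mathrm{KG}^r(n,k)$ induced by the $k$-subsets $\sigma\subseteq[n]$ with $\sigma\not\subseteq A$. *)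

theory Defs
  imports Complex_Main "HOL-Computational_Algebra.Primes"
begin

definition b_num :: "nat \<Rightarrow> nat" where
  "b_num r = 2 ^ multiplicity 2 r * (\<Prod>p \<in> prime_factors r - {2}. (p - 1) ^ multiplicity p r)"

text \<open>A hypergraph is a pair consisting of its vertex set and its set of hyperedges.\<close>

type_synonym 'a hypergraph = "'a set \<times> 'a set set"

definition verts :: "'a hypergraph \<Rightarrow> 'a set" where
  "verts H = fst H"

definition hyperedges :: "'a hypergraph \<Rightarrow> 'a set set" where
  "hyperedges H = snd H"

definition induced_subhypergraph :: "'a hypergraph \<Rightarrow> 'a set \<Rightarrow> 'a hypergraph" where
  "induced_subhypergraph H W = (verts H \<inter> W, {e \<in> hyperedges H. e \<subseteq> W})"

definition monochromatic :: "('a \<Rightarrow> nat) \<Rightarrow> 'a set \<Rightarrow> bool" where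
  "monochromatic c e \<longleftrightarrow> (\<exists>i. \<forall>v\<in>e. c v = i)"

definition is_coloring :: "'a hypergraph \<Rightarrow> nat \<Rightarrow> ('a \<Rightarrow> nat) \<Rightarrow> bool" where
  "is_coloring H m c \<longleftrightarrow>
     (\<forall>v\<in>verts H. c v \<in> {1..m}) \<and> (\<forall>e\<in>hyperedges H. \<not> monochromatic c e)"

definition chromatic_number :: "'a hypergraph \<Rightarrow> nat" where
  "chromatic_number H = (LEAST m. \<exists>c. is_coloring H m c)"

definition KG :: "nat \<Rightarrow> nat \<Rightarrow> nat \<Rightarrow> nat set hypergraph" where
  "KG r n k =
    (let V = {\<sigma>. \<sigma> \<subseteq> {1..n} \<and> card \<sigma> = k}
     in (V, {e. e \<subseteq> V \<and> card e = r \<and> pairwise disjnt e}))"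

definition KG_avoid :: "nat \<Rightarrow> nat set \<Rightarrow> nat \<Rightarrow> nat \<Rightarrow> nat set hypergraph" where
  "KG_avoid r A n k = induced_subhypergraph (KG r n k) {\<sigma>. \<not> \<sigma> \<subseteq> A}"

end

theory Submission
  imports Defs "HOL-Number_Theory.Cong"
begin

text \<open>Since \<open>b_num r \<le> r\<close>, it suffices to treat \<open>card A \<le> r * (k - 1)\<close>. For the lower bound one
  shows more generally, for \<open>card A \<le> r * a\<close>, that colouring the \<open>N\<close>-sets meeting \<open>A\<close> in at
  most \<open>a\<close> points with too few colours produces \<open>r\<close> disjoint sets of one colour. In this form the
  claim is multiplicative in \<open>r\<close>, so that \<open>r = p\<close> may be taken prime.

  For \<open>r = p\<close>, suppose there is no such family and consider ordered \<open>p\<close>-tuples of disjoint subsets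
  \<open>X\<^sub>i\<close> of the ground set \<open>V\<close>, not all empty. If no \<open>X\<^sub>i\<close> contains an admissible set, the tuple gets
  the rank obtained by summing \<open>min (card (X\<^sub>i \<inter> A)) a + card (X\<^sub>i - A)\<close>; otherwise its rank is
  \<open>p * (N - 1)\<close> plus the number of pairs of an index \<open>i\<close> and a colour \<open>v\<close> such that \<open>X\<^sub>i\<close> contains
  an admissible set of colour \<open>v\<close>. Comparable tuples of equal rank share the data from which an
  equivariant sign is computed; here \<open>card A \<le> p * a\<close> is needed, because if all the numbers
  \<open>min (card (X\<^sub>i \<inter> A)) a\<close> coincide then comparable tuples of equal rank are equal. A Tucker lemma for the cyclic group then bounds \<open>card V\<close> by the number of ranks.

  The Tucker lemma follows by evaluating an explicit cocycle of the cyclic group of order \<open>p\<close>, pulled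
  back along the sign, on a chain built by alternately coning and applying \<open>g - 1\<close> or the norm:
  the value is 1 modulo \<open>p\<close> by Stokes, but 0 if there are too few ranks.\<close>

section \<open>Cochains on lists\<close>

text \<open>The simplicial coboundary: an alternating sum over the deletions of one entry. A
  one-entry list yields \<open>f []\<close>, so the complex is augmented.\<close>

fun cobd :: "('a list \<Rightarrow> int) \<Rightarrow> 'a list \<Rightarrow> int" where
  "cobd f [] = 0"
| "cobd f (x # xs) = f xs - cobd (\<lambda>ys. f (x # ys)) xs"

text \<open>Dual to triangulating the prism between a simplex and its \<open>u\<close>-image: the
  list is cut at one entry, which is kept and followed by the images of itself and of all later
  entries.\<close>

fun prism :: "('a \<Rightarrow> 'a) \<Rightarrow> ('a list \<Rightarrow> int) \<Rightarrow> 'a list \<Rightarrow> int" where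
  "prism u f [] = 0"
| "prism u f (x # xs) = f (x # map u (x # xs)) - prism u (\<lambda>ys. f (x # ys)) xs"

text \<open>Dual to pushing a simplex along \<open>u\<close> through a prism and then coning its
  image from \<open>e\<close>.\<close>

definition contraction :: "'a \<Rightarrow> ('a \<Rightarrow> 'a) \<Rightarrow> ('a list \<Rightarrow> int) \<Rightarrow> 'a list \<Rightarrow> int" where
  "contraction e u f xs = f (e # map u xs) - prism u f xs"

lemma cobd_diff: "cobd (\<lambda>ys. f ys - g ys) xs = cobd f xs - cobd g xs"
  by (induction xs arbitrary: f g) simp_all

lemma cobd_sum: "cobd (\<lambda>ys. \<Sum>i\<in>I. f i ys) xs = (\<Sum>i\<in>I. cobd (f i) xs)"
  by (induction xs arbitrary: f) (simp_all add: sum_subtractf)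

lemma cobd_scale: "cobd (\<lambda>ys. c * f ys) xs = c * cobd f xs"
  by (induction xs arbitrary: f) (simp_all add: right_diff_distrib)

lemma cobd_map: "cobd (\<lambda>ys. f (map g ys)) xs = cobd f (map g xs)"
proof (induction xs arbitrary: f)
  case (Cons x xs)
  show ?case using Cons.IH[of "\<lambda>ys. f (g x # ys)"] by simp
qed simp

lemma prism_diff: "prism u (\<lambda>ys. f ys - g ys) xs = prism u f xs - prism u g xs"
  by (induction xs arbitrary: f g) simp_all

lemma prism_homotopy:
  "prism u (cobd f) xs + cobd (prism u f) xs = f (map u xs) - f xs"
proof (induction xs arbitrary: f)
  case (Cons x xs)
  have "cobd (\<lambda>ys. f (x # u x # map u ys)) xs = cobd (\<lambda>ys. f (x # u x # ys)) (map u xs)"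
    using cobd_map[of "\<lambda>ys. f (x # u x # ys)" u xs] by simp
  then show ?case
    using Cons.IH[of "\<lambda>ys. f (x # ys)"] by (simp add: prism_diff cobd_diff)
qed simp

text \<open>The term \<open>f (map u xs)\<close> occurs as the base of the cone and as the far end
  of the prism, and cancels. Thus the identity is null-homotopic.\<close>

lemma contraction_homotopy:
  "contraction e u (cobd f) xs = f xs - cobd (contraction e u f) xs"
  using prism_homotopy[of u f xs] cobd_map[of "\<lambda>ys. f (e # ys)" u xs]
  by (simp add: contraction_def[abs_def] cobd_diff)

lemma prism_cong:
  assumes "\<And>i. i < length xs \<Longrightarrow>
    [f (take (Suc i) xs @ map u (drop i xs)) = g (take (Suc i) xs @ map u (drop i xs))] (mod m)"
  shows "[prism u f xs = prism u g xs] (mod m)"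
  using assms
proof (induction xs arbitrary: f g)
  case (Cons x xs)
  have "[prism u (\<lambda>ys. f (x # ys)) xs = prism u (\<lambda>ys. g (x # ys)) xs] (mod m)"
    using Cons.prems[of "Suc i" for i] by (intro Cons.IH) simp
  moreover have "[f (x # map u (x # xs)) = g (x # map u (x # xs))] (mod m)"
    using Cons.prems[of 0] by simp
  ultimately show ?case by (simp add: cong_diff)
qed simp

section \<open>Cocycles of the cyclic group\<close>

definition descent :: "nat \<Rightarrow> nat \<Rightarrow> int" where
  "descent x y = (if y < x then 1 else 0)"

text \<open>The coboundary of \<open>descent\<close>. It vanishes when \<open>y\<close> equals
  \<open>x\<close> or \<open>z\<close>, and it is invariant under the cyclic shift although
  \<open>descent\<close> is not.\<close>

definition orient :: "nat \<Rightarrow> nat \<Rightarrow> nat \<Rightarrow> int" where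
  "orient x y z = descent y z - descent x z + descent x y"

text \<open>Cup powers of the 2-cocycle \<open>orient\<close>: consecutive factors share one entry.
  The odd cocycles put the 1-cocycle \<open>y - x\<close> in front.\<close>

fun cocycle_even :: "nat list \<Rightarrow> int" where
  "cocycle_even (x # y # z # zs) = orient x y z * cocycle_even (z # zs)"
| "cocycle_even xs = 1"

fun cocycle_odd :: "nat list \<Rightarrow> int" where
  "cocycle_odd (x # y # ys) = (int y - int x) * cocycle_even (y # ys)"
| "cocycle_odd xs = 0"

definition cocycle :: "nat \<Rightarrow> nat list \<Rightarrow> int" where
  "cocycle q = (if even q then cocycle_even else cocycle_odd)"

text \<open>The primitives trade the first factor of the next cocycle for a cochain that it is the
  coboundary of: \<open>x\<close> for \<open>y - x\<close>, and \<open>descent\<close> for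
  \<open>orient\<close>.\<close>

fun primitive_even :: "nat list \<Rightarrow> int" where
  "primitive_even (x # xs) = int x * cocycle_even (x # xs)"
| "primitive_even [] = 0"

fun primitive_odd :: "nat list \<Rightarrow> int" where
  "primitive_odd (x # y # ys) = descent x y * cocycle_even (y # ys)"
| "primitive_odd xs = 0"

definition primitive :: "nat \<Rightarrow> nat list \<Rightarrow> int" where
  "primitive q = (if even q then primitive_even else primitive_odd)"

text \<open>After the induction hypothesis the remaining factor is the coboundary of
  \<open>orient\<close>, which is zero because \<open>orient\<close> is itself a coboundary.\<close>

lemma cobd_cocycle_even: "even (length xs) \<Longrightarrow> cobd cocycle_even xs = 0"
proof (induction xs rule: induct_list012)
  case (3 x y zs)
  show ?case
  proof (cases zs)
    case (Cons z zs')
    with 3 obtain w r where zs: "zs = z # w # r"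
      by (cases zs') auto
    have "even (length (z # w # r))" using 3(3) zs by simp
    then have "cobd cocycle_even (z # w # r) = 0" using 3(1) zs by simp
    then have IH: "cobd (\<lambda>ys. cocycle_even (z # ys)) (w # r) = cocycle_even (w # r)"
      by simp
    have "cobd (\<lambda>ys. cocycle_even (x # y # z # ys)) (w # r)
        = orient x y z * cocycle_even (w # r)"
      using IH by (simp only: cocycle_even.simps cobd_scale)
    then have "cobd cocycle_even (x # y # z # w # r)
        = (orient y z w - orient x z w + orient x y w - orient x y z) * cocycle_even (w # r)"
      by (simp only: cobd.simps(2)[of _ x] cobd.simps(2)[of _ y] cobd.simps(2)[of _ z]
          cocycle_even.simps) (simp add: algebra_simps)
    also have "orient y z w - orient x z w + orient x y w - orient x y z = 0"
      by (simp add: orient_def)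
    finally show ?thesis using zs by simp
  qed simp
qed simp_all

lemma cobd_cocycle_even_Cons:
  assumes "odd (length xs)"
  shows "cobd (\<lambda>ys. cocycle_even (x # ys)) xs = cocycle_even xs"
  using cobd_cocycle_even[of "x # xs"] assms by simp

lemma cobd_primitive:
  assumes "length xs = Suc (Suc q)"
  shows "cobd (primitive q) xs = cocycle (Suc q) xs"
proof (cases "even q")
  case True
  obtain x y r where xs: "xs = x # y # r"
    using assms by (cases xs; cases "tl xs") auto
  have "cobd (\<lambda>ys. int x * cocycle_even (x # ys)) (y # r) = int x * cocycle_even (y # r)"
    using assms True xs by (simp only: cobd_scale, subst cobd_cocycle_even_Cons) auto
  then show ?thesis
    using True xs by (simp add: primitive_def cocycle_def algebra_simps)
next
  case False
  then obtain x y z r where xs: "xs = x # y # z # r"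
    using assms by (cases xs; cases "tl xs"; cases "tl (tl xs)") auto
  have "cobd (\<lambda>ys. descent x y * cocycle_even (y # ys)) (z # r)
      = descent x y * cocycle_even (z # r)"
    using assms False xs by (simp only: cobd_scale, subst cobd_cocycle_even_Cons) auto
  then show ?thesis
    using False xs by (simp add: primitive_def cocycle_def orient_def algebra_simps)
qed

text \<open>In odd length every adjacent pair lies inside one \<open>orient\<close> factor, and this
  factor vanishes when the pair is constant.\<close>

lemma cocycle_even_nonzero_imp:
  "cocycle_even xs \<noteq> 0 \<Longrightarrow> odd (length xs) \<Longrightarrow> successively (\<noteq>) xs"
proof (induction xs rule: cocycle_even.induct)
  case (1 x y z zs)
  then have "orient x y z \<noteq> 0" "successively (\<noteq>) (z # zs)" by auto
  then show ?case by (auto simp: orient_def descent_def)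
qed auto

lemma cocycle_nonzero_imp:
  assumes "cocycle q xs \<noteq> 0" "length xs = Suc q"
  shows "successively (\<noteq>) xs"
proof (cases "even q")
  case True
  then show ?thesis using assms cocycle_even_nonzero_imp by (simp add: cocycle_def)
next
  case False
  then obtain x y r where xs: "xs = x # y # r"
    using assms by (cases xs; cases "tl xs") auto
  then show ?thesis
    using assms False cocycle_even_nonzero_imp[of "y # r"] by (auto simp: cocycle_def)
qed

section \<open>The cyclic shift\<close>

definition shift :: "nat \<Rightarrow> nat \<Rightarrow> nat" where
  "shift p i = (i + 1) mod p"

lemma shift_less: "p > 0 \<Longrightarrow> shift p i < p"
  by (simp add: shift_def)

lemma shift_funpow: "i < p \<Longrightarrow> (shift p ^^ j) i = (i + j) mod p"
  by (induction j) (simp_all add: shift_def mod_Suc_eq)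

lemma shift_funpow_self: "i < p \<Longrightarrow> (shift p ^^ p) i = i"
  by (simp add: shift_funpow)

lemma bij_betw_shift:
  assumes "p > 0"
  shows "bij_betw (shift p) {..<p} {..<p}"
proof -
  have "inj_on (shift p) {..<p}"
  proof (rule inj_onI)
    fix x y assume "x \<in> {..<p}" "y \<in> {..<p}" "shift p x = shift p y"
    then show "x = y"
      by (cases "Suc x = p"; cases "Suc y = p") (auto simp: shift_def)
  qed
  moreover have "shift p ` {..<p} \<subseteq> {..<p}" using assms shift_less by auto
  ultimately show ?thesis
    by (simp add: bij_betw_def endo_inj_surj)
qed

text \<open>The change is the coboundary of the indicator function of \<open>p - 1\<close>; hence
  \<open>orient\<close> does not change at all.\<close>

lemma descent_shift:
  assumes "x < p" "y < p"
  shows "descent (shift p x) (shift p y)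
    = descent x y - (if Suc x = p then 1 else 0) + (if Suc y = p then 1 else 0)"
  using assms by (cases "Suc x = p"; cases "Suc y = p") (auto simp: shift_def descent_def)

lemma orient_shift:
  assumes "x < p" "y < p" "z < p"
  shows "orient (shift p x) (shift p y) (shift p z) = orient x y z"
  using assms by (simp add: orient_def descent_shift)

lemma cocycle_even_shift:
  "set xs \<subseteq> {..<p} \<Longrightarrow> cocycle_even (map (shift p) xs) = cocycle_even xs"
  by (induction xs rule: cocycle_even.induct) (simp_all add: orient_shift)

lemma cocycle_even_shift_funpow:
  assumes "set xs \<subseteq> {..<p}"
  shows "cocycle_even (map (shift p ^^ j) xs) = cocycle_even xs"
proof (induction j)
  case (Suc j)
  have "set (map (shift p ^^ j) xs) \<subseteq> {..<p}"
    using assms by (auto simp: shift_funpow)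
  then have "cocycle_even (map (shift p) (map (shift p ^^ j) xs)) = cocycle_even (map (shift p ^^ j) xs)"
    by (rule cocycle_even_shift)
  then show ?case using Suc by (simp add: comp_def)
qed simp

lemma sum_shift_funpow:
  assumes "x < p"
  shows "(\<Sum>j<p. int ((shift p ^^ j) x)) = (\<Sum>j<p. int j)"
proof -
  have "inj_on (\<lambda>j. (x + j) mod p) {..<p}"
  proof (rule inj_onI)
    fix i j assume ij: "i \<in> {..<p}" "j \<in> {..<p}" "(x + i) mod p = (x + j) mod p"
    then have "[x + i = x + j] (mod p)" by (simp add: cong_def)
    then have "[i = j] (mod p)" by (simp add: cong_add_lcancel_nat)
    then show "i = j" using ij by (simp add: cong_def)
  qed
  moreover have "(\<lambda>j. (x + j) mod p) ` {..<p} \<subseteq> {..<p}" using assms by auto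
  ultimately have "bij_betw (\<lambda>j. (x + j) mod p) {..<p} {..<p}"
    by (simp add: bij_betw_def endo_inj_surj)
  from sum.reindex_bij_betw[OF this, of int] show ?thesis
    using assms by (simp add: shift_funpow)
qed

text \<open>Along the orbit the difference of the two values is the residue \<open>d\<close> of
  \<open>y - x\<close>, lowered by \<open>p\<close> exactly at the descents. Both orbits run through
  all residues, so the differences sum to 0 and there are \<open>d\<close> descents.\<close>

lemma sum_descent_shift:
  assumes "x < p" "y < p"
  shows "[(\<Sum>j<p. descent ((shift p ^^ j) x) ((shift p ^^ j) y)) = int y - int x] (mod int p)"
proof -
  define d where "d = (int y - int x) mod int p"
  have step: "int ((shift p ^^ j) y) - int ((shift p ^^ j) x)
    = d - int p * descent ((shift p ^^ j) x) ((shift p ^^ j) y)" for j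
  proof -
    define x' y' where "x' = (x + j) mod p" and "y' = (y + j) mod p"
    have "x' < p" "y' < p" using assms by (simp_all add: x'_def y'_def)
    have "[int y' - int x' = int (y + j) - int (x + j)] (mod int p)"
      unfolding x'_def y'_def of_nat_mod by (intro cong_diff) simp_all
    then have d: "d = (int y' - int x') mod int p"
      by (simp add: d_def cong_def)
    have "d = int y' - int x' + int p * descent x' y'"
    proof (cases "y' < x'")
      case True
      have "(int y' - int x') mod int p = (int y' - int x' + int p) mod int p" by simp
      also have "\<dots> = int y' - int x' + int p"
        using True \<open>x' < p\<close> by (intro mod_pos_pos_trivial) auto
      finally show ?thesis using True d by (simp add: descent_def)
    next
      case False
      then show ?thesis using d \<open>y' < p\<close> by (simp add: descent_def)
    qed
    then show ?thesis using assms by (simp add: shift_funpow x'_def y'_def)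
  qed
  have "0 = (\<Sum>j<p. int ((shift p ^^ j) y) - int ((shift p ^^ j) x))"
    using assms by (simp add: sum_subtractf sum_shift_funpow)
  also have "\<dots> = int p * d - int p * (\<Sum>j<p. descent ((shift p ^^ j) x) ((shift p ^^ j) y))"
    by (simp add: step sum_subtractf sum_distrib_left)
  finally have "(\<Sum>j<p. descent ((shift p ^^ j) x) ((shift p ^^ j) y)) = d"
    using assms by simp
  then show ?thesis by (simp add: d_def cong_def)
qed

text \<open>Odd transfers are $g - 1$ and even ones are the norm $1 + g + \dots + g^{p-1}$, the two
  maps of the periodic resolution of the cyclic group.\<close>

definition transfer :: "nat \<Rightarrow> ('a \<Rightarrow> 'a) \<Rightarrow> nat \<Rightarrow> ('a list \<Rightarrow> int) \<Rightarrow> 'a list \<Rightarrow> int" where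
  "transfer p g q f xs =
    (if odd q then f (map g xs) - f xs else (\<Sum>j<p. f (map (g ^^ j) xs)))"

text \<open>For even \<open>q\<close>, applying \<open>g - 1\<close> raises the factor
  \<open>x\<close> by 1 modulo \<open>p\<close>. For odd \<open>q\<close>, the norm counts the
  descents along the orbit, which gives \<open>y - x\<close> modulo \<open>p\<close>.\<close>

lemma transfer_primitive:
  assumes "length xs = Suc q" "set xs \<subseteq> {..<p}"
  shows "[transfer p (shift p) (Suc q) (primitive q) xs = cocycle q xs] (mod int p)"
proof (cases "even q")
  case True
  obtain x r where xs: "xs = x # r" using assms by (cases xs) auto
  have "cocycle_even (map (shift p) (x # r)) = cocycle_even (x # r)"
    using assms xs cocycle_even_shift by blast
  then have *: "transfer p (shift p) (Suc q) (primitive q) xs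
      = (int (shift p x) - int x) * cocycle_even xs"
    using True xs by (simp add: transfer_def primitive_def algebra_simps)
  have "[int (shift p x) = int (x + 1)] (mod int p)"
    unfolding shift_def of_nat_mod by simp
  then have "[int (shift p x) - int x = int (x + 1) - int x] (mod int p)"
    by (intro cong_diff) simp_all
  then have "[(int (shift p x) - int x) * cocycle_even xs = 1 * cocycle_even xs] (mod int p)"
    by (intro cong_mult) simp_all
  then show ?thesis using True * by (simp add: cocycle_def)
next
  case False
  then obtain x y r where xs: "xs = x # y # r"
    using assms by (cases xs; cases "tl xs") auto
  have "cocycle_even (map (shift p ^^ j) (y # r)) = cocycle_even (y # r)" for j
    using assms xs by (intro cocycle_even_shift_funpow) auto
  then have "transfer p (shift p) (Suc q) (primitive q) xs
      = (\<Sum>j<p. descent ((shift p ^^ j) x) ((shift p ^^ j) y)) * cocycle_even (y # r)"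
    using False xs by (simp add: transfer_def primitive_def sum_distrib_right)
  moreover have "[(\<Sum>j<p. descent ((shift p ^^ j) x) ((shift p ^^ j) y)) * cocycle_even (y # r)
      = (int y - int x) * cocycle_even (y # r)] (mod int p)"
    using assms xs by (intro cong_mult sum_descent_shift) auto
  ultimately show ?thesis using False xs by (simp add: cocycle_def)
qed

section \<open>A Tucker lemma for the cyclic group\<close>

text \<open>A point of the join of \<open>card W\<close> copies of the cyclic group is a partial map from \<open>W\<close>
  to \<open>{..<p}\<close>; flags of partial maps are the simplices of its barycentric subdivision, with
  repetitions allowed.\<close>

definition act :: "nat \<Rightarrow> ('a \<Rightarrow> nat option) \<Rightarrow> 'a \<Rightarrow> nat option" where
  "act p X = map_option (shift p) \<circ> X"

definition pmaps :: "nat \<Rightarrow> 'a set \<Rightarrow> ('a \<Rightarrow> nat option) set" where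
  "pmaps p W = {X. X \<noteq> Map.empty \<and> dom X \<subseteq> W \<and> ran X \<subseteq> {..<p}}"

definition flags :: "nat \<Rightarrow> 'a set \<Rightarrow> nat \<Rightarrow> ('a \<Rightarrow> nat option) list set" where
  "flags p W q = {xs. length xs = Suc q \<and> sorted_wrt (\<subseteq>\<^sub>m) xs \<and> set xs \<subseteq> pmaps p W}"

lemma act_funpow: "(act p ^^ j) X = map_option (shift p ^^ j) \<circ> X"
  by (induction j) (auto simp: act_def option.map_comp fun_eq_iff comp_def option.map_ident)

lemma act_funpow_self:
  assumes "ran X \<subseteq> {..<p}"
  shows "(act p ^^ p) X = X"
proof
  fix a
  show "(act p ^^ p) X a = X a"
    using assms by (cases "X a") (auto simp: act_funpow ran_def shift_funpow_self)
qed

lemma act_in_pmaps: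
  assumes "p > 0" "X \<in> pmaps p W"
  shows "act p X \<in> pmaps p W"
proof -
  have "dom (act p X) = dom X" by (auto simp: act_def)
  moreover have "ran (act p X) \<subseteq> {..<p}"
    using assms(1) by (auto simp: act_def ran_def shift_less)
  ultimately show ?thesis
    using assms(2) unfolding pmaps_def mem_Collect_eq dom_eq_empty_conv[symmetric] by simp
qed

lemma act_funpow_in_pmaps:
  assumes "p > 0" "X \<in> pmaps p W"
  shows "(act p ^^ j) X \<in> pmaps p W"
  using assms by (induction j) (auto simp: act_in_pmaps)

lemma act_funpow_mono: "X \<subseteq>\<^sub>m Y \<Longrightarrow> (act p ^^ j) X \<subseteq>\<^sub>m (act p ^^ j) Y"
  by (auto simp: act_funpow map_le_def dom_def)

lemma map_act_funpow_in_flags: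
  assumes "p > 0" "xs \<in> flags p W q"
  shows "map (act p ^^ j) xs \<in> flags p W q"
proof -
  have "sorted_wrt (\<lambda>X Y. (act p ^^ j) X \<subseteq>\<^sub>m (act p ^^ j) Y) xs"
    using assms(2) by (auto simp: flags_def act_funpow_mono elim!: sorted_wrt_mono_rel[rotated])
  then show ?thesis
    using assms by (auto simp: flags_def sorted_wrt_map act_funpow_in_pmaps)
qed

lemma transfer_cong:
  assumes "p > 0" "xs \<in> flags p W q"
    and "\<And>ys. ys \<in> flags p W q \<Longrightarrow> [f ys = g ys] (mod m)"
  shows "[transfer p (act p) k f xs = transfer p (act p) k g xs] (mod m)"
proof -
  have *: "[f (map (act p ^^ j) xs) = g (map (act p ^^ j) xs)] (mod m)" for j
    using assms map_act_funpow_in_flags by blast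
  show ?thesis
    using *[of 0] *[of 1] * by (simp add: transfer_def cong_diff cong_sum)
qed

section \<open>Cones and prisms over flags\<close>

lemma cone_in_flags:
  assumes "inj_on c {..Suc q}" "p > 0" "xs \<in> flags p (c ` {..q}) q"
  shows "[c (Suc q) \<mapsto> 0] # map (\<lambda>X. X(c (Suc q) \<mapsto> 0)) xs \<in> flags p (c ` {..Suc q}) (Suc q)"
proof -
  have "sorted_wrt (\<lambda>X Y. X(c (Suc q) \<mapsto> 0) \<subseteq>\<^sub>m Y(c (Suc q) \<mapsto> 0)) xs"
    using assms(3)
    by (auto simp: flags_def intro: map_le_upd elim!: sorted_wrt_mono_rel[rotated])
  moreover have "X(c (Suc q) \<mapsto> 0) \<in> pmaps p (c ` {..Suc q})" if "X \<in> set xs" for X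
  proof -
    have "dom X \<subseteq> c ` {..q}" "ran X \<subseteq> {..<p}"
      using that assms(3) by (auto simp: flags_def pmaps_def)
    then have "dom (X(c (Suc q) \<mapsto> 0)) \<subseteq> c ` {..Suc q}"
      by (auto simp: atMost_Suc)
    moreover have "ran (X(c (Suc q) \<mapsto> 0)) \<subseteq> {..<p}"
      using \<open>ran X \<subseteq> {..<p}\<close> assms(2) by (auto simp: ran_def)
    ultimately show ?thesis by (simp add: pmaps_def)
  qed
  moreover have "[c (Suc q) \<mapsto> 0] \<in> pmaps p (c ` {..Suc q})"
    using assms(2) by (auto simp: pmaps_def ran_def fun_eq_iff split: if_splits)
  ultimately show ?thesis
    using assms(3) by (auto simp: flags_def sorted_wrt_map map_le_def split: if_splits)
qed

text \<open>By injectivity \<open>c (Suc q)\<close> is a new coordinate, so assigning it a value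
  enlarges each partial map of the flag; the unextended maps therefore lie below the extended
  ones.\<close>

lemma prism_in_flags:
  assumes "inj_on c {..Suc q}" "p > 0" "xs \<in> flags p (c ` {..q}) q" "i < length xs"
  shows "take (Suc i) xs @ map (\<lambda>X. X(c (Suc q) \<mapsto> 0)) (drop i xs)
    \<in> flags p (c ` {..Suc q}) (Suc q)"
proof -
  let ?u = "\<lambda>X. X(c (Suc q) \<mapsto> 0)"
  have xs: "length xs = Suc q" "sorted_wrt (\<subseteq>\<^sub>m) xs" "set xs \<subseteq> pmaps p (c ` {..q})"
    using assms(3) by (auto simp: flags_def)
  have "sorted_wrt (\<subseteq>\<^sub>m) (map ?u xs)" "set (map ?u xs) \<subseteq> pmaps p (c ` {..Suc q})"
    using cone_in_flags[OF assms(1-3)] by (auto simp: flags_def)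
  then have u: "sorted_wrt (\<subseteq>\<^sub>m) (map ?u (drop i xs))"
    "set (map ?u (drop i xs)) \<subseteq> pmaps p (c ` {..Suc q})"
    using set_drop_subset[of i "map ?u xs"] by (auto simp only: drop_map[symmetric] intro: sorted_wrt_drop)
  have "pmaps p (c ` {..q}) \<subseteq> pmaps p (c ` {..Suc q})"
    by (fastforce simp: pmaps_def)
  then have t: "set (take (Suc i) xs) \<subseteq> pmaps p (c ` {..Suc q})"
    using xs(3) by (auto dest!: in_set_takeD)
  have le: "X \<subseteq>\<^sub>m ?u Y" if X: "X \<in> set (take (Suc i) xs)" and Y: "Y \<in> set (drop i xs)" for X Y
  proof -
    obtain j where "j < length (take (Suc i) xs)" "X = take (Suc i) xs ! j"
      using X by (metis in_set_conv_nth)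
    then have j: "j \<le> i" "X = xs ! j" by simp_all
    obtain l where "l < length (drop i xs)" "Y = drop i xs ! l"
      using Y by (metis in_set_conv_nth)
    then have l: "i + l < length xs" "Y = xs ! (i + l)" using assms(4) by simp_all
    have "X \<subseteq>\<^sub>m Y"
    proof (cases "j = i + l")
      case False
      then show ?thesis using sorted_wrt_nth_less[OF xs(2), of j "i + l"] j l by simp
    qed (use j l in simp)
    have "X \<in> set xs" using X by (rule in_set_takeD)
    then have "dom X \<subseteq> c ` {..q}" using xs(3) by (auto simp: pmaps_def)
    moreover have "c (Suc q) \<notin> c ` {..q}"
    proof
      assume "c (Suc q) \<in> c ` {..q}"
      then obtain k where "k \<le> q" "c (Suc q) = c k" by auto
      then show False using inj_onD[OF assms(1), of "Suc q" k] by simp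
    qed
    ultimately have "c (Suc q) \<notin> dom X" by blast
    then show ?thesis using \<open>X \<subseteq>\<^sub>m Y\<close> by (auto simp: map_le_def)
  qed
  show ?thesis
    using xs u t le assms(4)
    by (auto simp: flags_def sorted_wrt_append intro: sorted_wrt_take)
qed

lemma contraction_cong:
  assumes "inj_on c {..Suc q}" "p > 0" "xs \<in> flags p (c ` {..q}) q"
    and "\<And>ys. ys \<in> flags p (c ` {..Suc q}) (Suc q) \<Longrightarrow> [f ys = g ys] (mod m)"
  shows "[contraction [c (Suc q) \<mapsto> 0] (\<lambda>X. X(c (Suc q) \<mapsto> 0)) f xs
    = contraction [c (Suc q) \<mapsto> 0] (\<lambda>X. X(c (Suc q) \<mapsto> 0)) g xs] (mod m)"
  unfolding contraction_def
  using assms cone_in_flags prism_in_flags by (intro cong_diff prism_cong) blast+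

text \<open>\<open>evaluate p c q\<close> pairs a cochain with the \<open>q\<close>-chain \<open>h\<^sub>q\<close> determined by coning:
  \<open>h\<^sub>0\<close> is a vertex and \<open>h\<^sub>q\<close> fills the cycle obtained from \<open>h\<^bsub>q - 1\<^esub>\<close> by transfer.\<close>

fun evaluate :: "nat \<Rightarrow> (nat \<Rightarrow> 'a) \<Rightarrow> nat \<Rightarrow> (('a \<Rightarrow> nat option) list \<Rightarrow> int) \<Rightarrow> int" where
  "evaluate p c 0 f = f [[c 0 \<mapsto> 0]]"
| "evaluate p c (Suc q) f = evaluate p c q (transfer p (act p) (Suc q)
     (contraction [c (Suc q) \<mapsto> 0] (\<lambda>X. X(c (Suc q) \<mapsto> 0)) f))"

text \<open>The chain paired with is supported on flags over the first \<open>q + 1\<close>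
  coordinates, so only the values there matter.\<close>

lemma evaluate_cong:
  assumes "inj_on c {..q}" "p > 0"
    and "\<And>xs. xs \<in> flags p (c ` {..q}) q \<Longrightarrow> [f xs = g xs] (mod m)"
  shows "[evaluate p c q f = evaluate p c q g] (mod m)"
  using assms
proof (induction q arbitrary: f g)
  case 0
  have "[[c 0 \<mapsto> 0]] \<in> flags p (c ` {..0}) 0"
    using 0(2) by (auto simp: flags_def pmaps_def ran_def fun_eq_iff split: if_splits)
  then show ?case using 0 by simp
next
  case (Suc q)
  have "inj_on c {..q}" using Suc.prems(1) by (rule inj_on_subset) auto
  then show ?case
    unfolding evaluate.simps using Suc.prems
    by (intro Suc.IH transfer_cong[where W = "c ` {..q}" and q = q] contraction_cong) auto
qed

section \<open>Stokes' formula for the chains \<open>h\<^sub>q\<close>\<close>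

lemma transfer_diff:
  "transfer p h k (\<lambda>ys. f ys - g ys) = (\<lambda>xs. transfer p h k f xs - transfer p h k g xs)"
  by (auto simp: transfer_def sum_subtractf)

lemma contraction_diff:
  "contraction e u (\<lambda>ys. f ys - g ys) = (\<lambda>xs. contraction e u f xs - contraction e u g xs)"
  by (auto simp: contraction_def prism_diff)

lemma evaluate_diff:
  "evaluate p c q (\<lambda>ys. f ys - g ys) = evaluate p c q f - evaluate p c q g"
  by (induction q arbitrary: f g) (simp_all add: transfer_diff contraction_diff)

lemma evaluate_zero: "evaluate p c q (\<lambda>_. 0) = 0"
  using evaluate_diff[of p c q "\<lambda>_. 0" "\<lambda>_. 0"] by simp

lemma transfer_cobd: "transfer p h k (cobd f) = cobd (transfer p h k f)"
proof
  fix xs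
  show "transfer p h k (cobd f) xs = cobd (transfer p h k f) xs"
    by (simp add: transfer_def[abs_def] cobd_diff cobd_sum cobd_map)
qed

text \<open>One of the two transfers is \<open>g - 1\<close> and the other the norm. Their composite
  telescopes to the difference between \<open>g ^ p\<close> and the identity.\<close>

lemma transfer_transfer:
  assumes "map (h ^^ p) xs = xs"
  shows "transfer p h k (transfer p h (Suc k) f) xs = 0"
proof -
  have "map (h ^^ j) (map h xs) = map (h ^^ Suc j) xs" for j
    by (simp add: funpow_swap1)
  moreover have "map h (map (h ^^ j) xs) = map (h ^^ Suc j) xs" for j
    by simp
  moreover have "(\<Sum>j<p. f (map (h ^^ Suc j) xs) - f (map (h ^^ j) xs)) = 0"
    using sum_lessThan_telescope[of "\<lambda>j. f (map (h ^^ j) xs)" p] assms by simp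
  ultimately show ?thesis
    by (simp only: transfer_def) (simp flip: sum_subtractf)
qed

text \<open>The boundary of the chain in degree \<open>q + 1\<close> is the transfer of the chain in
  degree \<open>q\<close>. The contraction homotopy leaves a correction, the coboundary of a
  transfer; Stokes one degree lower turns it into two successive transfers, hence into 0.\<close>

lemma evaluate_cobd:
  assumes "inj_on c {..Suc q}" "p > 0"
  shows "[evaluate p c (Suc q) (cobd f) = evaluate p c q (transfer p (act p) (Suc q) f)] (mod m)"
  using assms
proof (induction q arbitrary: f)
  case 0
  \<comment> \<open>On a vertex the correction is the value at \<open>[]\<close> of a transfer by
    \<open>g - 1\<close>, which is 0.\<close>
  show ?case
    by (simp add: contraction_homotopy[abs_def] transfer_diff transfer_cobd)
      (simp add: transfer_def)
next
  case (Suc q)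
  let ?h = "contraction [c (Suc (Suc q)) \<mapsto> 0] (\<lambda>X. X(c (Suc (Suc q)) \<mapsto> 0)) f"
  have inj: "inj_on c {..Suc q}" "inj_on c {..q}"
    using Suc.prems(1) by (auto intro: inj_on_subset)
  have "[evaluate p c (Suc q) (cobd (transfer p (act p) (Suc (Suc q)) ?h))
      = evaluate p c q (transfer p (act p) (Suc q) (transfer p (act p) (Suc (Suc q)) ?h))] (mod m)"
    using inj Suc.prems by (intro Suc.IH)
  also have "[evaluate p c q (transfer p (act p) (Suc q) (transfer p (act p) (Suc (Suc q)) ?h))
      = evaluate p c q (\<lambda>_. 0)] (mod m)"
  proof (rule evaluate_cong[OF inj(2) Suc.prems(2)])
    fix xs assume "xs \<in> flags p (c ` {..q}) q"
    then have "map (act p ^^ p) xs = xs"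
      by (intro map_idI) (auto simp: flags_def pmaps_def intro!: act_funpow_self)
    then show "[transfer p (act p) (Suc q) (transfer p (act p) (Suc (Suc q)) ?h) xs = 0] (mod m)"
      by (simp add: transfer_transfer)
  qed
  finally have z: "[evaluate p c (Suc q) (cobd (transfer p (act p) (Suc (Suc q)) ?h)) = 0] (mod m)"
    by (simp add: evaluate_zero)
  have "evaluate p c (Suc (Suc q)) (cobd f)
      = evaluate p c (Suc q) (transfer p (act p) (Suc (Suc q)) f)
      - evaluate p c (Suc q) (cobd (transfer p (act p) (Suc (Suc q)) ?h))"
    by (subst evaluate.simps(2))
      (simp only: contraction_homotopy[abs_def] transfer_diff transfer_cobd evaluate_diff)
  then show ?case
    using cong_diff[OF cong_refl z] by simp
qed

text \<open>Each cocycle of positive degree is the coboundary of a primitive. Stokes replaces it by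
  the transfer of that primitive, which modulo \<open>p\<close> is the cocycle one degree lower;
  equivariance of \<open>s\<close> lets the transfer pass through the pullback. In degree 0 the
  value is 1.\<close>

lemma evaluate_cocycle:
  fixes s :: "('a \<Rightarrow> nat option) \<Rightarrow> nat"
  assumes "inj_on c {..q}" "p > 0"
    and "\<And>X. X \<in> pmaps p (c ` {..q}) \<Longrightarrow> s X < p"
    and "\<And>X. X \<in> pmaps p (c ` {..q}) \<Longrightarrow> s (act p X) = shift p (s X)"
  shows "[evaluate p c q (\<lambda>xs. cocycle q (map s xs)) = 1] (mod int p)"
  using assms
proof (induction q)
  case 0
  then show ?case by (simp add: cocycle_def)
next
  case (Suc q)
  let ?f = "\<lambda>ys. primitive q (map s ys)"
  note s_act = Suc.prems(4)
  have inj: "inj_on c {..q}"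
    using Suc.prems(1) by (auto intro: inj_on_subset)
  have sub: "pmaps p (c ` {..q}) \<subseteq> pmaps p (c ` {..Suc q})"
    by (fastforce simp: pmaps_def)
  have "cocycle (Suc q) (map s xs) = cobd ?f xs" if "xs \<in> flags p (c ` {..Suc q}) (Suc q)" for xs
    using that by (simp add: cobd_map cobd_primitive flags_def)
  then have "[evaluate p c (Suc q) (\<lambda>xs. cocycle (Suc q) (map s xs))
      = evaluate p c (Suc q) (cobd ?f)] (mod int p)"
    using Suc.prems by (intro evaluate_cong) auto
  also have "[evaluate p c (Suc q) (cobd ?f)
      = evaluate p c q (transfer p (act p) (Suc q) ?f)] (mod int p)"
    using Suc.prems by (intro evaluate_cobd)
  also have "[evaluate p c q (transfer p (act p) (Suc q) ?f)
      = evaluate p c q (\<lambda>xs. cocycle q (map s xs))] (mod int p)"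
  proof (rule evaluate_cong[OF inj Suc.prems(2)])
    fix xs assume xs: "xs \<in> flags p (c ` {..q}) q"
    have "s ((act p ^^ j) X) = (shift p ^^ j) (s X)" if "X \<in> set xs" for X j
    proof (induction j)
      case (Suc j)
      have "(act p ^^ j) X \<in> pmaps p (c ` {..Suc q})"
        using that xs sub \<open>p > 0\<close> by (intro act_funpow_in_pmaps) (auto simp: flags_def)
      then show ?case using Suc s_act by simp
    qed simp
    then have "map s (map (act p ^^ j) xs) = map (shift p ^^ j) (map s xs)" for j
      by simp
    from this[of 1] this have "transfer p (act p) (Suc q) ?f xs
        = transfer p (shift p) (Suc q) (primitive q) (map s xs)"
      by (simp add: transfer_def del: map_map)
    also have "[transfer p (shift p) (Suc q) (primitive q) (map s xs)
        = cocycle q (map s xs)] (mod int p)"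
      using xs sub Suc.prems(3) by (intro transfer_primitive) (auto simp: flags_def)
    finally show "[transfer p (act p) (Suc q) ?f xs = cocycle q (map s xs)] (mod int p)" .
  qed
  also have "[evaluate p c q (\<lambda>xs. cocycle q (map s xs)) = 1] (mod int p)"
    using inj sub Suc.prems by (intro Suc.IH) auto
  finally show ?case .
qed

text \<open>With more than \<open>D\<close> coordinates the chain of degree \<open>D\<close> exists
  and pairs to 1 with the pulled-back cocycle. But a flag where the cocycle is nonzero changes sign
  at each of its \<open>D\<close> steps, so its rank grows strictly and takes \<open>D + 1\<close>
  values in \<open>{1..D}\<close>.\<close>

theorem cyclic_Tucker:
  fixes s \<rho> :: "('a \<Rightarrow> nat option) \<Rightarrow> nat"
  assumes "finite V" "p \<ge> 2"
    and s_less: "\<And>X. X \<in> pmaps p V \<Longrightarrow> s X < p"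
    and s_act: "\<And>X. X \<in> pmaps p V \<Longrightarrow> s (act p X) = shift p (s X)"
    and rank: "\<And>X. X \<in> pmaps p V \<Longrightarrow> \<rho> X \<in> {1..D}"
    and mono: "\<And>X Y. X \<in> pmaps p V \<Longrightarrow> Y \<in> pmaps p V \<Longrightarrow> X \<subseteq>\<^sub>m Y \<Longrightarrow> \<rho> X \<le> \<rho> Y"
    and sign: "\<And>X Y. X \<in> pmaps p V \<Longrightarrow> Y \<in> pmaps p V \<Longrightarrow> X \<subseteq>\<^sub>m Y \<Longrightarrow> \<rho> X = \<rho> Y \<Longrightarrow> s X = s Y"
  shows "card V \<le> D"
proof (rule ccontr)
  assume "\<not> card V \<le> D"
  obtain c where c: "bij_betw c {0..<card V} V"
    using ex_bij_betw_nat_finite[OF \<open>finite V\<close>] by blast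
  have inj: "inj_on c {..D}"
    using c \<open>\<not> card V \<le> D\<close> by (auto simp: bij_betw_def intro: inj_on_subset)
  have "c ` {..D} \<subseteq> V"
    using c \<open>\<not> card V \<le> D\<close> by (auto simp: bij_betw_def)
  then have sub: "pmaps p (c ` {..D}) \<subseteq> pmaps p V"
    unfolding pmaps_def by blast
  have zero: "cocycle D (map s xs) = 0" if xs: "xs \<in> flags p (c ` {..D}) D" for xs
  proof (rule ccontr)
    assume "cocycle D (map s xs) \<noteq> 0"
    then have "successively (\<noteq>) (map s xs)"
      using xs by (intro cocycle_nonzero_imp) (auto simp: flags_def)
    then have succ: "successively (\<lambda>X Y. s X \<noteq> s Y) xs"
      by (simp add: successively_map)
    have in_V: "set xs \<subseteq> pmaps p V" using xs sub by (auto simp: flags_def)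
    have "successively (\<subseteq>\<^sub>m) xs"
      using xs by (auto simp: flags_def intro: successively_if_sorted_wrt)
    then have "successively (\<lambda>X Y. \<rho> X < \<rho> Y) xs"
      using succ in_V
    proof (induction xs rule: induct_list012)
      case (3 X Y zs)
      then have "\<rho> X \<le> \<rho> Y" "\<rho> X \<noteq> \<rho> Y" using mono sign by auto
      then show ?case using 3 by auto
    qed auto
    then have "sorted_wrt (<) (map \<rho> xs)"
      by (simp add: successively_map flip: successively_conv_sorted_wrt)
    then have "distinct (map \<rho> xs)" by (simp add: strict_sorted_iff)
    from distinct_card[OF this] have "card (\<rho> ` set xs) = Suc D"
      using xs by (simp add: flags_def)
    moreover have "\<rho> ` set xs \<subseteq> {1..D}" using rank in_V by auto
    then have "card (\<rho> ` set xs) \<le> D" using card_mono[of "{1..D}"] by simp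
    ultimately show False by simp
  qed
  have "[evaluate p c D (\<lambda>xs. cocycle D (map s xs)) = evaluate p c D (\<lambda>_. 0)] (mod int p)"
    using inj \<open>p \<ge> 2\<close> zero by (intro evaluate_cong) auto
  moreover have "[evaluate p c D (\<lambda>xs. cocycle D (map s xs)) = 1] (mod int p)"
    using inj \<open>p \<ge> 2\<close> s_less s_act sub by (intro evaluate_cocycle) auto
  ultimately have "[0 = 1] (mod int p)"
    by (metis cong_sym cong_trans evaluate_zero)
  then show False using \<open>p \<ge> 2\<close> by (simp add: cong_def)
qed

section \<open>Equivariant signs\<close>

text \<open>A partial map into the indices encodes an ordered tuple of disjoint sets; this is the
  member with index \<open>i\<close>.\<close>

definition fibre :: "('a \<Rightarrow> nat option) \<Rightarrow> nat \<Rightarrow> 'a set" where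
  "fibre X i = {a. X a = Some i}"

lemma fibre_act:
  assumes "ran X \<subseteq> {..<p}" "i < p"
  shows "fibre (act p X) (shift p i) = fibre X i"
proof -
  have "p > 0" using assms(2) by simp
  from bij_betw_shift[OF this] have inj: "inj_on (shift p) {..<p}"
    by (simp add: bij_betw_def)
  have "shift p j = shift p i \<longleftrightarrow> j = i" if "X a = Some j" for a j
  proof -
    have "j < p" using that assms(1) by (auto simp: ran_def)
    then show ?thesis using inj_on_eq_iff[OF inj, of j i] assms(2) by simp
  qed
  then show ?thesis by (auto simp: fibre_def act_def)
qed

lemma fibre_disjoint: "i \<noteq> j \<Longrightarrow> fibre X i \<inter> fibre X j = {}"
  by (auto simp: fibre_def)

lemma fibre_mono: "X \<subseteq>\<^sub>m Y \<Longrightarrow> fibre X i \<subseteq> fibre Y i"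
  by (force simp: fibre_def map_le_def dom_def)

lemma fibre_subset: "X \<in> pmaps p V \<Longrightarrow> fibre X i \<subseteq> V"
  by (auto simp: fibre_def pmaps_def)

lemma map_eq_if_fibre_eq:
  assumes "ran X \<subseteq> {..<p}" "ran Y \<subseteq> {..<p}" "\<And>i. i < p \<Longrightarrow> fibre X i = fibre Y i"
  shows "X = Y"
proof
  fix a
  have "X a = Some i \<longleftrightarrow> Y a = Some i" for i
  proof (cases "i < p")
    case True
    then show ?thesis using assms(3)[of i] by (auto simp: fibre_def)
  next
    case False
    then show ?thesis using assms(1,2) by (auto simp: ran_def)
  qed
  then show "X a = Y a" by (metis option.exhaust)
qed

text \<open>Dividing by \<open>card B\<close> modulo the prime \<open>p\<close> is what makes the average equivariant.\<close>

definition average :: "nat \<Rightarrow> nat set \<Rightarrow> nat" where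
  "average p B = (SOME u. [card B * u = 1] (mod p)) * \<Sum>B mod p"

text \<open>For prime \<open>p\<close> this makes \<open>card B\<close> invertible modulo
  \<open>p\<close>.\<close>

definition proper :: "nat \<Rightarrow> nat set \<Rightarrow> bool" where
  "proper p B \<longleftrightarrow> 0 < card B \<and> card B < p"

lemma inj_on_shift:
  assumes "B \<subseteq> {..<p}"
  shows "inj_on (shift p) B"
proof (cases "p = 0")
  case False
  then show ?thesis
    using bij_betw_shift[of p] by (auto simp: bij_betw_def intro: inj_on_subset[OF _ assms])
qed (use assms in auto)

lemma card_shift: "B \<subseteq> {..<p} \<Longrightarrow> card (shift p ` B) = card B"
  by (intro card_image inj_on_shift)

text \<open>The shift adds \<open>card B\<close> to the sum modulo \<open>p\<close>, and the inverse
  of \<open>card B\<close> turns this into 1.\<close>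

lemma average_shift:
  assumes "prime p" "B \<subseteq> {..<p}" "proper p B"
  shows "average p (shift p ` B) = shift p (average p B)"
proof -
  define u where "u = (SOME u. [card B * u = 1] (mod p))"
  have "coprime (card B) p"
    using assms(1,3)
    by (metis coprime_commute dvd_imp_le leD prime_imp_coprime proper_def)
  then obtain u' where "[card B * u' = 1] (mod p)"
    using cong_solve_coprime_nat by auto
  then have u: "[card B * u = 1] (mod p)"
    unfolding u_def by (rule someI)
  have "[(\<Sum>b\<in>B. shift p b) = (\<Sum>b\<in>B. b + 1)] (mod p)"
    by (intro cong_sum) (simp add: shift_def)
  then have "[u * (\<Sum>b\<in>B. shift p b) = u * (\<Sum>B + card B)] (mod p)"
    by (intro cong_mult) (simp_all only: sum.distrib cong_refl card_eq_sum)
  also have "u * (\<Sum>B + card B) = u * \<Sum>B + card B * u"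
    by (simp add: algebra_simps)
  also have "[u * \<Sum>B + card B * u = u * \<Sum>B + 1] (mod p)"
    using u by (intro cong_add) simp_all
  finally have "u * (\<Sum>b\<in>B. shift p b) mod p = (u * \<Sum>B + 1) mod p"
    by (simp add: cong_def)
  moreover have "\<Sum>(shift p ` B) = (\<Sum>b\<in>B. shift p b)"
    using sum.reindex[OF inj_on_shift[OF assms(2)], of "\<lambda>x. x"] by simp
  moreover have "average p (shift p ` B) = u * \<Sum>(shift p ` B) mod p" "average p B = u * \<Sum>B mod p"
    by (simp_all only: average_def card_shift[OF assms(2)] u_def)
  ultimately show ?thesis
    by (simp add: shift_def mod_Suc_eq)
qed

definition family_sign :: "nat \<Rightarrow> ('i \<Rightarrow> nat set) \<Rightarrow> nat" where
  "family_sign p F = average p (F (SOME j. proper p (F j)))"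

lemma family_sign_less: "p > 0 \<Longrightarrow> family_sign p F < p"
  by (simp add: family_sign_def average_def)

text \<open>The shift does not affect which members are proper, so \<open>SOME\<close> picks the
  same index in both families.\<close>

lemma family_sign_shift:
  assumes "prime p" "\<And>j. F j \<subseteq> {..<p}" "\<And>j. F' j = shift p ` F j" "\<exists>j. proper p (F j)"
  shows "family_sign p F' = shift p (family_sign p F)"
proof -
  have "proper p (F' j) = proper p (F j)" for j
    using assms(2,3) by (simp add: proper_def card_shift)
  moreover have "proper p (F (SOME j. proper p (F j)))"
    using assms(4) by (rule someI_ex)
  ultimately show ?thesis
    using assms by (simp add: family_sign_def average_shift)
qed

section \<open>Index sets cut out by properties of the fibres\<close>

definition selected :: "nat \<Rightarrow> ('i \<Rightarrow> 'a set \<Rightarrow> bool) \<Rightarrow> ('a \<Rightarrow> nat option) \<Rightarrow> 'i \<Rightarrow> nat set" where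
  "selected p Q X j = {i. i < p \<and> Q j (fibre X i)}"

lemma selected_subset: "selected p Q X j \<subseteq> {..<p}"
  by (auto simp: selected_def)

lemma finite_selected: "finite (selected p Q X j)"
  by (simp add: selected_def)

lemma selected_act:
  assumes "p > 0" "ran X \<subseteq> {..<p}"
  shows "selected p Q (act p X) j = shift p ` selected p Q X j"
proof -
  have "shift p ` {..<p} = {..<p}"
    using bij_betw_shift[OF assms(1)] by (simp add: bij_betw_def)
  then have "selected p Q (act p X) j = {i \<in> shift p ` {..<p}. Q j (fibre (act p X) i)}"
    by (auto simp: selected_def)
  also have "\<dots> = shift p ` {i. i < p \<and> Q j (fibre (act p X) (shift p i))}" by auto
  also have "\<dots> = shift p ` selected p Q X j"
    using fibre_act[OF assms(2)] unfolding selected_def by (metis (no_types, lifting))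
  finally show ?thesis .
qed

lemma proper_selected_act:
  assumes "p > 0" "ran X \<subseteq> {..<p}"
  shows "proper p (selected p Q (act p X) j) = proper p (selected p Q X j)"
  by (simp add: selected_act[OF assms] proper_def card_shift[OF selected_subset])

lemma family_sign_selected_act:
  assumes "prime p" "ran X \<subseteq> {..<p}" "\<exists>j. proper p (selected p Q X j)"
  shows "family_sign p (selected p Q (act p X)) = shift p (family_sign p (selected p Q X))"
  using assms prime_gt_0_nat[OF assms(1)]
  by (intro family_sign_shift) (auto simp: selected_act selected_subset)

section \<open>Monochromatic disjoint families\<close>

text \<open>The admissible sets. For \<open>a = k - 1\<close> and \<open>N = k\<close> these are the
  \<open>k\<close>-sets not contained in \<open>A\<close>; free \<open>a\<close> and
  \<open>N\<close> allow the induction over the factors of \<open>r\<close>.\<close>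

definition thin_set :: "'a set \<Rightarrow> 'a set \<Rightarrow> nat \<Rightarrow> nat \<Rightarrow> 'a set \<Rightarrow> bool" where
  "thin_set V A a N S \<longleftrightarrow> S \<subseteq> V \<and> card S = N \<and> card (S \<inter> A) \<le> a"

definition mono_matching ::
    "'a set \<Rightarrow> 'a set \<Rightarrow> nat \<Rightarrow> nat \<Rightarrow> ('a set \<Rightarrow> 'c) \<Rightarrow> nat \<Rightarrow> 'c \<Rightarrow> 'a set set \<Rightarrow> bool" where
  "mono_matching V A a N col r v E \<longleftrightarrow>
    card E = r \<and> pairwise disjnt E \<and> (\<forall>S\<in>E. thin_set V A a N S \<and> col S = v)"

text \<open>The bound on \<open>card V\<close> exceeds the largest rank by 1: tuples without
  admissible sets reach at most \<open>p * (N - 1)\<close>, and each colour then contributes at most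
  \<open>p - 1\<close>.\<close>

lemma mono_matching_prime:
  fixes V A :: "'a set" and col :: "'a set \<Rightarrow> 'c"
  assumes "prime p" "finite V" "A \<subseteq> V" "card A \<le> p * a" "N \<ge> 1" "finite C"
    and col: "\<And>S. thin_set V A a N S \<Longrightarrow> col S \<in> C"
    and size: "card V \<ge> (p - 1) * card C + p * (N - 1) + 1"
  shows "\<exists>v E. mono_matching V A a N col p v E"
proof (rule ccontr)
  assume none: "\<not> ?thesis"
  have "p \<ge> 2" using \<open>prime p\<close> by (rule prime_ge_2_nat)
  have "finite A" using \<open>A \<subseteq> V\<close> \<open>finite V\<close> by (rule finite_subset)
  \<comment> \<open>Three sources for the sign, tried in this order: indices whose fibre contains an
    admissible set of a colour, indices whose truncated count passes a threshold, indices whose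
    fibre contains a given point.\<close>
  define Q1 where "Q1 = (\<lambda>v B. \<exists>S\<subseteq>B. thin_set V A a N S \<and> col S = v)"
  define Q2 where "Q2 = (\<lambda>c B. c \<le> min (card (B \<inter> A)) a)"
  define Q3 where "Q3 = (\<lambda>(b::'a) B. b \<in> B)"
  define F1 where "F1 = selected p Q1"
  define F2 where "F2 = selected p Q2"
  define F3 where "F3 = selected p Q3"
  define t where "t = (\<lambda>X i. min (card (fibre X i \<inter> A)) a)"
  define w where "w = (\<lambda>X i. t X i + card (fibre X i - A))"
  define large where "large = (\<lambda>X. \<exists>v. proper p (F1 X v))"
  define \<rho> where "\<rho> = (\<lambda>X. if large X then p * (N - 1) + (\<Sum>v\<in>C. card (F1 X v)) else (\<Sum>i<p. w X i))"
  define s where "s = (\<lambda>X. if large X then family_sign p (F1 X)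
      else if \<exists>c. proper p (F2 X c) then family_sign p (F2 X) else family_sign p (F3 X))"
  have finite_fibre: "finite (fibre X i)" if "X \<in> pmaps p V" for X i
    using fibre_subset[OF that] \<open>finite V\<close> by (rule finite_subset)
  \<comment> \<open>If every fibre contained an admissible set of colour \<open>v\<close>, these
    \<open>p\<close> disjoint sets would be the excluded family.\<close>
  have F1_card: "card (F1 X v) < p" for X v
  proof (rule ccontr)
    assume "\<not> card (F1 X v) < p"
    then have "F1 X v = {..<p}"
      unfolding F1_def using selected_subset[of p Q1 X v] by (intro card_seteq) auto
    then have "\<forall>i<p. \<exists>S\<subseteq>fibre X i. thin_set V A a N S \<and> col S = v"
      by (auto simp: F1_def selected_def Q1_def)
    then obtain S where S: "\<And>i. i < p \<Longrightarrow> S i \<subseteq> fibre X i \<and> thin_set V A a N (S i) \<and> col (S i) = v"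
      by metis
    have disj: "S i \<inter> S j = {}" if "i < p" "j < p" "i \<noteq> j" for i j
      using S[OF that(1)] S[OF that(2)] fibre_disjoint[OF that(3), of X] by blast
    have "S i \<noteq> {}" if "i < p" for i
      using S[OF that] \<open>N \<ge> 1\<close> by (auto simp: thin_set_def)
    then have "inj_on S {..<p}"
      using disj by (intro inj_onI) (metis inf.idem lessThan_iff)
    then have "mono_matching V A a N col p v (S ` {..<p})"
      unfolding mono_matching_def pairwise_def disjnt_def using S disj
      by (simp add: card_image) (metis imageE lessThan_iff)
    then show False using none by blast
  qed
  have F1_proper: "proper p (F1 X v) \<longleftrightarrow> F1 X v \<noteq> {}" for X v
    using F1_card[of X v] by (auto simp: proper_def F1_def finite_selected card_gt_0_iff)
  have F1_empty: "F1 X v = {}" if "v \<notin> C" for X v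
    using that col by (auto simp: F1_def selected_def Q1_def)
  have w_small: "w X i \<le> N - 1" if "\<not> large X" "X \<in> pmaps p V" "i < p" for X i
  proof (rule ccontr)
    assume "\<not> w X i \<le> N - 1"
    \<comment> \<open>Keeping only \<open>t X i\<close> points of the fibre inside \<open>A\<close>
      leaves \<open>w X i\<close> points, any \<open>N\<close> of which form an admissible
      set.\<close>
    have "t X i \<le> card (fibre X i \<inter> A)" by (simp add: t_def)
    from obtain_subset_with_card_n[OF this]
    obtain B where B: "B \<subseteq> fibre X i \<inter> A" "card B = t X i" by blast
    have fin: "finite (fibre X i)" using finite_fibre that(2) by blast
    then have "finite B" using B(1) by (meson finite_Int finite_subset)
    have "card (B \<union> (fibre X i - A)) = w X i"
      using B fin \<open>finite B\<close> by (subst card_Un_disjoint) (auto simp: w_def)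
    then have "N \<le> card (B \<union> (fibre X i - A))" using \<open>\<not> w X i \<le> N - 1\<close> by linarith
    from obtain_subset_with_card_n[OF this]
    obtain S where S: "S \<subseteq> B \<union> (fibre X i - A)" "card S = N" by blast
    have "S \<inter> A \<subseteq> B" using S(1) by auto
    then have "card (S \<inter> A) \<le> t X i" using B(2) card_mono[OF \<open>finite B\<close>] by metis
    then have "card (S \<inter> A) \<le> a" by (simp add: t_def)
    moreover have "S \<subseteq> fibre X i" using S(1) B(1) by auto
    ultimately have "i \<in> F1 X (col S)"
      using S(2) fibre_subset[OF that(2), of i] that(3)
      by (auto simp: F1_def selected_def Q1_def thin_set_def)
    then show False using that(1) F1_proper by (auto simp: large_def)
  qed
  have F1_mono: "F1 X v \<subseteq> F1 Y v" if "X \<subseteq>\<^sub>m Y" for X Y v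
  proof
    fix i assume "i \<in> F1 X v"
    then obtain S where "i < p" "S \<subseteq> fibre X i" "thin_set V A a N S" "col S = v"
      by (auto simp: F1_def selected_def Q1_def)
    moreover have "S \<subseteq> fibre Y i" using \<open>S \<subseteq> fibre X i\<close> fibre_mono[OF that] by (rule order_trans)
    ultimately show "i \<in> F1 Y v" by (auto simp: F1_def selected_def Q1_def)
  qed
  have large_mono: "large Y" if "X \<subseteq>\<^sub>m Y" "large X" for X Y
    using F1_mono[OF that(1)] that(2) unfolding large_def F1_proper by blast
  have t_mono: "t X i \<le> t Y i" if "X \<subseteq>\<^sub>m Y" "Y \<in> pmaps p V" for X Y i
  proof -
    have "card (fibre X i \<inter> A) \<le> card (fibre Y i \<inter> A)"
      using fibre_mono[OF that(1), of i] finite_fibre[OF that(2)] by (intro card_mono) auto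
    then show ?thesis by (auto simp: t_def)
  qed
  have o_mono: "card (fibre X i - A) \<le> card (fibre Y i - A)"
    if "X \<subseteq>\<^sub>m Y" "Y \<in> pmaps p V" for X Y i
    using fibre_mono[OF that(1), of i] finite_fibre[OF that(2)] by (intro card_mono) auto
  have w_mono: "w X i \<le> w Y i" if "X \<subseteq>\<^sub>m Y" "Y \<in> pmaps p V" for X Y i
    unfolding w_def using t_mono[OF that] o_mono[OF that] by (rule add_mono)
  have small_le: "(\<Sum>i<p. w X i) \<le> p * (N - 1)" if "\<not> large X" "X \<in> pmaps p V" for X
    using sum_bounded_above[of "{..<p}" "w X" "N - 1"] w_small[OF that] by simp
  have large_pos: "0 < (\<Sum>v\<in>C. card (F1 X v))" if X: "large X" for X
  proof -
    obtain v where v: "proper p (F1 X v)" using X by (auto simp: large_def)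
    then have "v \<in> C" using F1_empty F1_proper by blast
    then show ?thesis
      using v \<open>finite C\<close> by (intro sum_pos2[of _ v]) (auto simp: proper_def)
  qed
  have large_le: "(\<Sum>v\<in>C. card (F1 X v)) \<le> (p - 1) * card C" for X
  proof -
    have "card (F1 X v) \<le> p - 1" for v using F1_card[of X v] by simp
    then show ?thesis
      using sum_bounded_above[of C "\<lambda>v. card (F1 X v)" "p - 1"] by (simp add: mult.commute)
  qed
  have small_pos: "0 < (\<Sum>i<p. w X i)" if X: "X \<in> pmaps p V" for X
  proof -
    obtain b i where b: "X b = Some i" using X by (auto simp: pmaps_def fun_eq_iff)
    then have "i < p" using that by (auto simp: pmaps_def ran_def)
    have fin: "finite (fibre X i)" using finite_fibre that by blast
    have bf: "b \<in> fibre X i" using b by (simp add: fibre_def)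
    have "0 < w X i"
    proof (cases "b \<in> A")
      case True
      \<comment> \<open>A point of \<open>A\<close> forces \<open>a > 0\<close> through
        \<open>card A \<le> p * a\<close>, so the truncation at \<open>a\<close> does not lose
        it.\<close>
      then have "0 < card A" using \<open>finite A\<close> by (auto simp: card_gt_0_iff)
      then have "0 < a" using \<open>card A \<le> p * a\<close> by (cases a) auto
      moreover have "0 < card (fibre X i \<inter> A)" using fin True bf by (auto simp: card_gt_0_iff)
      ultimately show ?thesis by (simp add: w_def t_def)
    next
      case False
      then have "0 < card (fibre X i - A)" using fin bf by (auto simp: card_gt_0_iff)
      then show ?thesis by (simp add: w_def)
    qed
    then show ?thesis using \<open>i < p\<close> by (intro sum_pos2[of _ i]) auto
  qed
  have F2_eq: "F2 X c = {i. i < p \<and> c \<le> t X i}" for X c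
    by (auto simp: F2_def selected_def Q2_def t_def)
  have t_const: "t X i = t X 0" if "\<not> (\<exists>c. proper p (F2 X c))" "i < p" for X i
  proof (rule ccontr)
    assume ne: "t X i \<noteq> t X 0"
    \<comment> \<open>The larger of two different counts is a threshold that one index passes and
      the other does not.\<close>
    define c where "c = max (t X i) (t X 0)"
    have "i \<in> F2 X c \<or> 0 \<in> F2 X c" using that(2) by (auto simp: F2_eq c_def max_def)
    then have "0 < card (F2 X c)" by (auto simp: card_gt_0_iff F2_def finite_selected)
    have "\<not> c \<le> t X i \<or> \<not> c \<le> t X 0" using ne by (simp add: c_def)
    then have "i \<notin> F2 X c \<or> 0 \<notin> F2 X c" by (simp add: F2_eq)
    moreover have "F2 X c \<subseteq> {..<p}" by (auto simp: F2_eq)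
    ultimately have "F2 X c \<subset> {..<p}" using that(2) \<open>p \<ge> 2\<close> by auto
    then have "card (F2 X c) < p" using psubset_card_mono[of "{..<p}"] by simp
    then show False using that(1) \<open>0 < card (F2 X c)\<close> unfolding proper_def by blast
  qed
  have F3_proper: "\<exists>b. proper p (F3 X b)" if X: "X \<in> pmaps p V" for X
  proof -
    obtain b i where b: "X b = Some i" using X by (auto simp: pmaps_def fun_eq_iff)
    then have "i < p" using that by (auto simp: pmaps_def ran_def)
    then have "F3 X b = {i}" using b by (auto simp: F3_def selected_def Q3_def fibre_def)
    then show ?thesis using \<open>p \<ge> 2\<close> by (auto simp: proper_def intro!: exI[of _ b])
  qed
  have "card V \<le> (p - 1) * card C + p * (N - 1)"
  proof (rule cyclic_Tucker[OF \<open>finite V\<close> \<open>p \<ge> 2\<close>, where s = s and \<rho> = \<rho>])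
    fix X assume X: "X \<in> pmaps p V"
    show "s X < p"
      using \<open>p \<ge> 2\<close> by (simp add: s_def family_sign_less)
    have ran: "p > 0" "ran X \<subseteq> {..<p}" using X \<open>p \<ge> 2\<close> by (auto simp: pmaps_def)
    show "s (act p X) = shift p (s X)"
      using F3_proper[OF X] family_sign_selected_act[OF \<open>prime p\<close> ran(2), of Q1]
        family_sign_selected_act[OF \<open>prime p\<close> ran(2), of Q2]
        family_sign_selected_act[OF \<open>prime p\<close> ran(2), of Q3]
      unfolding s_def large_def F1_def F2_def F3_def proper_selected_act[OF ran] by presburger
    show "\<rho> X \<in> {1..(p - 1) * card C + p * (N - 1)}"
      using small_le[OF _ X] large_pos[of X] large_le[of X] small_pos[OF X]
      by (cases "large X") (auto simp: \<rho>_def)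
  next
    fix X Y assume X: "X \<in> pmaps p V" and Y: "Y \<in> pmaps p V" and le: "X \<subseteq>\<^sub>m Y"
    have F1_le: "card (F1 X v) \<le> card (F1 Y v)" for v
      using F1_mono[OF le] by (intro card_mono) (auto simp: F1_def finite_selected)
    show "\<rho> X \<le> \<rho> Y"
    proof (cases "large X")
      case True
      then show ?thesis using large_mono[OF le] F1_le by (simp add: \<rho>_def sum_mono)
    next
      case False
      show ?thesis
      proof (cases "large Y")
        case True
        then show ?thesis using False small_le[OF False X] by (simp add: \<rho>_def)
      next
        case False': False
        then show ?thesis using False w_mono[OF le Y] by (simp add: \<rho>_def sum_mono)
      qed
    qed
    assume eq: "\<rho> X = \<rho> Y"
    show "s X = s Y"
    proof (cases "large X")
      case True
      then have "large Y" using large_mono le by blast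
      then have sum_eq: "(\<Sum>v\<in>C. card (F1 X v)) = (\<Sum>v\<in>C. card (F1 Y v))"
        using eq True by (simp add: \<rho>_def)
      have "F1 X v = F1 Y v" for v
      proof (cases "v \<in> C")
        case v: True
        have "card (F1 X v) = card (F1 Y v)"
          using sum_mono_inv[OF sum_eq F1_le v \<open>finite C\<close>] .
        then show ?thesis
          using F1_mono[OF le] by (intro card_subset_eq) (auto simp: F1_def finite_selected)
      qed (simp add: F1_empty)
      then have "F1 X = F1 Y" by blast
      then show ?thesis using True \<open>large Y\<close> by (simp add: s_def)
    next
      case False
      \<comment> \<open>A large tuple has rank above \<open>p * (N - 1)\<close>, but the rank of
        \<open>X\<close> is at most that.\<close>
      have "\<not> large Y"
        using eq False small_le[OF False X] large_pos[of Y] by (auto simp: \<rho>_def)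
      then have sum_eq: "(\<Sum>i<p. w X i) = (\<Sum>i<p. w Y i)"
        using eq False by (simp add: \<rho>_def)
      have "w X i = w Y i" if "i < p" for i
        using sum_mono_inv[OF sum_eq w_mono[OF le Y]] that by simp
      \<comment> \<open>Both summands of \<open>w\<close> are monotone, so equality of the sums
        forces equality of each.\<close>
      then have t_eq: "t X i = t Y i" and o_eq: "card (fibre X i - A) = card (fibre Y i - A)"
        if "i < p" for i
        using that t_mono[OF le Y, of i] o_mono[OF le Y, of i] by (force simp: w_def)+
      have F2_XY: "F2 X = F2 Y" by (auto simp: F2_eq t_eq fun_eq_iff)
      show ?thesis
      proof (cases "\<exists>c. proper p (F2 X c)")
        case True
        then show ?thesis using False \<open>\<not> large Y\<close> F2_XY by (simp add: s_def)
      next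
        case const: False
        \<comment> \<open>No threshold separates the indices, so all truncated counts agree. This
          case is settled by showing \<open>X = Y\<close>.\<close>
        have inside: "fibre X i \<inter> A = fibre Y i \<inter> A" if "i < p" for i
        proof (cases "t X 0 < a")
          case True
          \<comment> \<open>Below \<open>a\<close> the truncation is inactive and the counts are
            true cardinalities.\<close>
          then have "t X i < a" "t Y i < a" using t_const[OF const that] t_eq[OF that] by auto
          then have "card (fibre X i \<inter> A) = card (fibre Y i \<inter> A)"
            using t_eq[OF that] by (auto simp: t_def)
          then show ?thesis
            using fibre_mono[OF le, of i] \<open>finite A\<close> by (intro card_subset_eq) auto
        next
          case False
          \<comment> \<open>All fibres meet \<open>A\<close> in at least \<open>a\<close> points, so they exhaust \<open>A\<close>.\<close>
          have "a \<le> card (fibre X j \<inter> A)" if "j < p" for j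
            using False t_const[OF const that] by (auto simp: t_def)
          then have "p * a \<le> (\<Sum>j<p. card (fibre X j \<inter> A))"
            using sum_bounded_below[of "{..<p}" a "\<lambda>j. card (fibre X j \<inter> A)"] by simp
          also have "\<dots> = card (\<Union>j<p. fibre X j \<inter> A)"
            using \<open>finite A\<close> fibre_disjoint[of _ _ X] by (intro card_UN_disjoint[symmetric]) auto
          finally have "(\<Union>j<p. fibre X j \<inter> A) = A"
            using \<open>card A \<le> p * a\<close> \<open>finite A\<close> by (intro card_seteq) auto
          have "b \<in> fibre X i" if b: "b \<in> fibre Y i" "b \<in> A" for b
          proof -
            obtain j where j: "j < p" "b \<in> fibre X j"
              using b(2) \<open>(\<Union>j<p. fibre X j \<inter> A) = A\<close> by blast
            then have "b \<in> fibre Y j" using fibre_mono[OF le] by blast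
            then have "j = i" using b(1) by (simp add: fibre_def)
            then show ?thesis using j by simp
          qed
          then show ?thesis using fibre_mono[OF le, of i] by blast
        qed
        have "fibre X i - A = fibre Y i - A" if "i < p" for i
          using o_eq[OF that] fibre_mono[OF le, of i] finite_fibre[OF Y, of i]
          by (intro card_subset_eq) auto
        then have "fibre X i = fibre Y i" if "i < p" for i
          using inside that by blast
        then have "X = Y"
          using X Y by (intro map_eq_if_fibre_eq[of X p Y]) (auto simp: pmaps_def)
        then show ?thesis by simp
      qed
    qed
  qed
  then show False using size by simp
qed

text \<open>Multiplicativity in \<open>r = p * d\<close>: every larger thin set is coloured by the
  colour of a family of \<open>d\<close> sets found inside it by induction. A family of
  \<open>p\<close> larger sets of one colour then yields \<open>p * d\<close> disjoint sets of that
  colour.\<close>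

lemma mono_matching_exists:
  fixes V A :: "'a set" and col :: "'a set \<Rightarrow> 'c"
  assumes "r \<ge> 1" "finite V" "A \<subseteq> V" "card A \<le> r * a" "N \<ge> 1" "finite C"
    and "\<And>S. thin_set V A a N S \<Longrightarrow> col S \<in> C"
    and "card V \<ge> (r - 1) * card C + r * (N - 1) + 1"
  shows "\<exists>v\<in>C. \<exists>E. mono_matching V A a N col r v E"
  using assms
proof (induction r arbitrary: V A rule: less_induct)
  case (less r)
  show ?case
  proof (cases "r = 1")
    case True
    have "N \<le> card V" using less.prems(5,8) True by simp
    from obtain_subset_with_card_n[OF this] obtain S where S: "S \<subseteq> V" "card S = N" by blast
    \<comment> \<open>Here \<open>card A \<le> a\<close>, so every \<open>N\<close>-subset is
      thin.\<close>
    have "finite A" using less.prems(2,3) by (rule finite_subset[rotated])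
    then have "card (S \<inter> A) \<le> card A" by (intro card_mono) auto
    then have "thin_set V A a N S"
      using S less.prems(4) True by (simp add: thin_set_def)
    then show ?thesis
      using less.prems(7) True
      by (intro bexI[of _ "col S"] exI[of _ "{S}"]) (auto simp: mono_matching_def)
  next
    case False
    then obtain p where "prime p" "p dvd r" using prime_factor_nat by blast
    then obtain d where r: "r = p * d" by auto
    have "p \<ge> 2" using \<open>prime p\<close> by (rule prime_ge_2_nat)
    have "d \<ge> 1" "d < r" using r less.prems(1) \<open>p \<ge> 2\<close> by (auto intro: Suc_leI)
    \<comment> \<open>The size of ground set that the induction hypothesis for \<open>d\<close>
      requires.\<close>
    define N' where "N' = (d - 1) * card C + d * (N - 1) + 1"
    have inner: "\<exists>v\<in>C. \<exists>E. mono_matching S (S \<inter> A) a N col d v E"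
      if S: "thin_set V A (d * a) N' S" for S
    proof (rule less.IH[OF \<open>d < r\<close> \<open>d \<ge> 1\<close>])
      show "finite S" using S less.prems(2) by (auto simp: thin_set_def intro: finite_subset)
      show "col T \<in> C" if "thin_set S (S \<inter> A) a N T" for T
      proof (rule less.prems(7))
        have "T \<inter> A = T \<inter> (S \<inter> A)" "T \<subseteq> V" using that S by (auto simp: thin_set_def)
        then show "thin_set V A a N T" using that by (simp add: thin_set_def)
      qed
    qed (use S less.prems in \<open>auto simp: thin_set_def N'_def\<close>)
    define col' where "col' S = (SOME v. v \<in> C \<and> (\<exists>E. mono_matching S (S \<inter> A) a N col d v E))" for S
    have col': "col' S \<in> C \<and> (\<exists>E. mono_matching S (S \<inter> A) a N col d (col' S) E)"
      if "thin_set V A (d * a) N' S" for S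
    proof -
      have "\<exists>v. v \<in> C \<and> (\<exists>E. mono_matching S (S \<inter> A) a N col d v E)"
        using inner[OF that] by blast
      from someI_ex[OF this] show ?thesis unfolding col'_def .
    qed
    have "\<exists>v \<E>. mono_matching V A (d * a) N' col' p v \<E>"
    proof (rule mono_matching_prime[OF \<open>prime p\<close> less.prems(2,3) _ _ \<open>finite C\<close>])
      show "card A \<le> p * (d * a)" using less.prems(4) r by (simp add: mult.assoc)
      obtain p' d' l where "p = Suc p'" "d = Suc d'" "N = Suc l"
        using \<open>p \<ge> 2\<close> \<open>d \<ge> 1\<close> \<open>N \<ge> 1\<close> by (metis Suc_le_D numeral_2_eq_2 One_nat_def)
      \<comment> \<open>The two thresholds compose exactly:
        \<open>p - 1 + p * (d - 1) = r - 1\<close>.\<close>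
      then have "(p - 1) * card C + p * (N' - 1) = (r - 1) * card C + r * (N - 1)"
        by (simp add: r N'_def algebra_simps)
      then show "(p - 1) * card C + p * (N' - 1) + 1 \<le> card V"
        using less.prems(8) by simp
    qed (use col' in \<open>auto simp: N'_def\<close>)
    then obtain v \<E> where \<E>: "mono_matching V A (d * a) N' col' p v \<E>" by blast
    have thin: "thin_set V A (d * a) N' S" "col' S = v" if "S \<in> \<E>" for S
      using \<E> that by (auto simp: mono_matching_def)
    have "\<forall>S\<in>\<E>. \<exists>E. mono_matching S (S \<inter> A) a N col d v E"
      using col' thin by metis
    then obtain E where E: "\<And>S. S \<in> \<E> \<Longrightarrow> mono_matching S (S \<inter> A) a N col d v (E S)"
      by metis
    have sub: "T \<subseteq> S" "T \<noteq> {}" "thin_set V A a N T" "col T = v" if "S \<in> \<E>" "T \<in> E S" for S T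
    proof -
      have T: "thin_set S (S \<inter> A) a N T" "col T = v"
        using E[OF that(1)] that(2) by (auto simp: mono_matching_def)
      then show "T \<subseteq> S" "T \<noteq> {}" "col T = v" using less.prems(5) by (auto simp: thin_set_def)
      then have "T \<inter> A = T \<inter> (S \<inter> A)" "T \<subseteq> V"
        using thin(1)[OF that(1)] by (auto simp: thin_set_def)
      then show "thin_set V A a N T" using T by (simp add: thin_set_def)
    qed
    have disj: "S \<inter> S' = {}" if "S \<in> \<E>" "S' \<in> \<E>" "S \<noteq> S'" for S S'
      using \<E> that by (auto simp: mono_matching_def pairwise_def disjnt_def)
    have card_E: "card (E S) = d" if "S \<in> \<E>" for S
      using E[OF that] by (simp add: mono_matching_def)
    have "card \<E> = p" using \<E> by (simp add: mono_matching_def)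
    then have "finite \<E>" using \<open>p \<ge> 2\<close> by (intro card_ge_0_finite) simp
    \<comment> \<open>A member common to two of the families would be a nonempty subset of two
      disjoint sets.\<close>
    have "card (\<Union>S\<in>\<E>. E S) = (\<Sum>S\<in>\<E>. card (E S))"
    proof (rule card_UN_disjoint)
      show "\<forall>S\<in>\<E>. finite (E S)" using card_E \<open>d \<ge> 1\<close> by (auto intro: card_ge_0_finite)
      show "\<forall>S\<in>\<E>. \<forall>S'\<in>\<E>. S \<noteq> S' \<longrightarrow> E S \<inter> E S' = {}"
      proof (intro ballI impI)
        fix S S' assume SS': "S \<in> \<E>" "S' \<in> \<E>" "S \<noteq> S'"
        show "E S \<inter> E S' = {}"
        proof (rule ccontr)
          assume "E S \<inter> E S' \<noteq> {}"
          then obtain T where T: "T \<in> E S" "T \<in> E S'" by blast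
          then show False
            using sub(1,2)[OF SS'(1) T(1)] sub(1)[OF SS'(2) T(2)] disj[OF SS'] by blast
        qed
      qed
    qed (fact \<open>finite \<E>\<close>)
    also have "\<dots> = r" using card_E \<open>card \<E> = p\<close> r by simp
    finally have card: "card (\<Union>S\<in>\<E>. E S) = r" .
    have "disjnt T T'" if TT': "T \<in> (\<Union>S\<in>\<E>. E S)" "T' \<in> (\<Union>S\<in>\<E>. E S)" "T \<noteq> T'" for T T'
    proof -
      obtain S S' where S: "S \<in> \<E>" "T \<in> E S" and S': "S' \<in> \<E>" "T' \<in> E S'"
        using TT' by blast
      show ?thesis
      proof (cases "S = S'")
        case True
        then show ?thesis using E[OF S(1)] S S' TT' by (auto simp: mono_matching_def pairwise_def)
      next
        case False
        then show ?thesis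
          using sub(1)[OF S] sub(1)[OF S'] disj[OF S(1) S'(1)] unfolding disjnt_def by blast
      qed
    qed
    then have "mono_matching V A a N col r v (\<Union>S\<in>\<E>. E S)"
      unfolding mono_matching_def pairwise_def using card sub(3,4) by blast
    moreover have "v \<in> C"
    proof -
      have "\<E> \<noteq> {}" using \<open>card \<E> = p\<close> \<open>p \<ge> 2\<close> by auto
      then show ?thesis using thin col' by (metis all_not_in_conv)
    qed
    ultimately show ?thesis by blast
  qed
qed

section \<open>Chromatic numbers\<close>

text \<open>Raising every odd factor \<open>p - 1\<close> to \<open>p\<close> turns
  \<open>b_num r\<close> into the prime factorization of \<open>r\<close>.\<close>

lemma b_num_le:
  assumes "r > 0"
  shows "b_num r \<le> r"
proof -
  let ?P = "prime_factors r"
  have "(\<Prod>p\<in>?P - {2}. (p - 1) ^ multiplicity p r) \<le> (\<Prod>p\<in>?P - {2}. p ^ multiplicity p r)"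
    by (intro prod_mono) (simp add: power_mono)
  then have "b_num r \<le> 2 ^ multiplicity 2 r * (\<Prod>p\<in>?P - {2}. p ^ multiplicity p r)"
    by (simp add: b_num_def)
  also have "\<dots> = (\<Prod>p\<in>?P. p ^ multiplicity p r)"
  proof (cases "2 \<in> ?P")
    case True
    then show ?thesis using prod.remove[of ?P 2 "\<lambda>p. p ^ multiplicity p r"] by simp
  next
    case False
    then have "multiplicity 2 r = 0"
      using assms by (auto simp: prime_factors_multiplicity)
    then show ?thesis using False by simp
  qed
  also have "\<dots> = r" using assms by (simp add: prod_prime_factors)
  finally show ?thesis .
qed

section \<open>Upper and lower bounds for the hypergraph\<close>

lemma KG_avoid_verts:
  "verts (KG_avoid r A n k) = {\<sigma>. \<sigma> \<subseteq> {1..n} \<and> card \<sigma> = k \<and> \<not> \<sigma> \<subseteq> A}"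
  by (auto simp: KG_avoid_def induced_subhypergraph_def KG_def verts_def Let_def)

lemma KG_avoid_hyperedges:
  "hyperedges (KG_avoid r A n k) =
    {e. e \<subseteq> verts (KG_avoid r A n k) \<and> card e = r \<and> pairwise disjnt e}"
  by (auto simp: KG_avoid_def induced_subhypergraph_def KG_def verts_def hyperedges_def Let_def)

lemma KG_avoid_colorable:
  assumes "r \<ge> 2" "k \<ge> 1" "M \<ge> 1" "n \<le> r * (k - 1) + M * (r - 1)"
  shows "\<exists>c. is_coloring (KG_avoid r A n k) M c"
proof
  \<comment> \<open>Kneser's colouring: the minimum of a set is located in blocks of length
    \<open>r - 1\<close>, and the last colour \<open>M\<close> absorbs all later blocks.\<close>
  define f where "f = (\<lambda>x. (x - 1) div (r - 1) + 1)"
  define c where "c = (\<lambda>\<sigma>::nat set. min M (f (Min \<sigma>)))"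
  show "is_coloring (KG_avoid r A n k) M c"
    unfolding is_coloring_def
  proof (intro conjI ballI)
    show "c \<sigma> \<in> {1..M}" for \<sigma> using \<open>M \<ge> 1\<close> by (simp add: c_def f_def)
  next
    fix e assume "e \<in> hyperedges (KG_avoid r A n k)"
    then have e: "card e = r" "pairwise disjnt e"
      and sets: "\<And>\<sigma>. \<sigma> \<in> e \<Longrightarrow> \<sigma> \<subseteq> {1..n} \<and> card \<sigma> = k"
      by (auto simp: KG_avoid_hyperedges KG_avoid_verts)
    have fin: "finite \<sigma>" "\<sigma> \<noteq> {}" if "\<sigma> \<in> e" for \<sigma>
      using sets[OF that] \<open>k \<ge> 1\<close> by (auto intro: finite_subset)
    have Min: "Min \<sigma> \<in> \<sigma>" "Min \<sigma> \<ge> 1" if "\<sigma> \<in> e" for \<sigma>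
    proof -
      show "Min \<sigma> \<in> \<sigma>" using fin[OF that] by simp
      then show "Min \<sigma> \<ge> 1" using sets[OF that] by auto
    qed
    have "finite e" using e(1) \<open>r \<ge> 2\<close> by (intro card_ge_0_finite) simp
    show "\<not> monochromatic c e"
    proof
      assume "monochromatic c e"
      then obtain i where i: "\<And>\<sigma>. \<sigma> \<in> e \<Longrightarrow> c \<sigma> = i" by (auto simp: monochromatic_def)
      show False
      proof (cases "i < M")
        case True
        \<comment> \<open>Disjoint sets have distinct minima, and a block has room for only
          \<open>r - 1\<close> of them.\<close>
        have block: "Min \<sigma> - 1 \<in> {(i - 1) * (r - 1)..<(i - 1) * (r - 1) + (r - 1)}" if "\<sigma> \<in> e" for \<sigma>
        proof -
          have "(Min \<sigma> - 1) div (r - 1) = i - 1"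
            using i[OF that] True by (simp add: c_def f_def min_def split: if_splits)
          moreover have "r - 1 > 0" using \<open>r \<ge> 2\<close> by simp
          ultimately show ?thesis
            using div_mult_mod_eq[of "Min \<sigma> - 1" "r - 1"] mod_less_divisor[of "r - 1" "Min \<sigma> - 1"]
            by (metis atLeastLessThan_iff le_add1 nat_add_left_cancel_less)
        qed
        have "inj_on (\<lambda>\<sigma>. Min \<sigma> - 1) e"
        proof (rule inj_onI)
          fix \<sigma> \<tau> assume st: "\<sigma> \<in> e" "\<tau> \<in> e" "Min \<sigma> - 1 = Min \<tau> - 1"
          then have "Min \<sigma> = Min \<tau>" using Min(2)[OF st(1)] Min(2)[OF st(2)] by simp
          then show "\<sigma> = \<tau>"
            using Min(1)[OF st(1)] Min(1)[OF st(2)] e(2) st(1,2)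
            by (auto simp: pairwise_def disjnt_def)
        qed
        then have "card e \<le> card {(i - 1) * (r - 1)..<(i - 1) * (r - 1) + (r - 1)}"
          using block by (intro card_inj_on_le) auto
        then show False using e(1) \<open>r \<ge> 2\<close> by simp
      next
        case False
        \<comment> \<open>All sets of the last colour lie beyond the first \<open>M - 1\<close>
          blocks, where at most \<open>r * k - 1\<close> points remain; an edge covers
          \<open>r * k\<close> points.\<close>
        have sub: "\<Union>e \<subseteq> {(M - 1) * (r - 1)<..n}"
        proof
          fix x assume "x \<in> \<Union>e"
          then obtain \<sigma> where \<sigma>: "\<sigma> \<in> e" "x \<in> \<sigma>" by blast
          have "M - 1 \<le> (Min \<sigma> - 1) div (r - 1)"
            using i[OF \<sigma>(1)] False by (simp add: c_def f_def min_def split: if_splits)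
          then have "(M - 1) * (r - 1) \<le> Min \<sigma> - 1"
            by (meson div_times_less_eq_dividend le_trans mult_le_mono1)
          moreover have "Min \<sigma> \<le> x" using fin[OF \<sigma>(1)] \<sigma>(2) by simp
          ultimately have "(M - 1) * (r - 1) < x" using Min(2)[OF \<sigma>(1)] by simp
          then show "x \<in> {(M - 1) * (r - 1)<..n}" using sets[OF \<sigma>(1)] \<sigma>(2) by auto
        qed
        have "card (\<Union>e) = (\<Sum>\<sigma>\<in>e. card \<sigma>)"
          using e(2) fin by (intro card_Union_disjoint) auto
        then have "card (\<Union>e) = r * k" using sets e(1) by simp
        moreover have "card (\<Union>e) \<le> n - (M - 1) * (r - 1)"
          using card_mono[OF _ sub] by simp
        moreover obtain M' k' r' where "M = Suc M'" "k = Suc k'" "r = Suc r'"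
          using assms by (metis Suc_le_D One_nat_def numeral_2_eq_2)
        ultimately show False using assms(4) by (simp add: algebra_simps)
      qed
    qed
  qed
qed

text \<open>A \<open>k\<close>-set with at most \<open>k - 1\<close> points in \<open>A\<close> is a
  vertex, so a monochromatic family of \<open>r\<close> disjoint such sets is a monochromatic
  hyperedge.\<close>

lemma KG_avoid_not_colorable:
  assumes "r \<ge> 1" "k \<ge> 1" "A \<subseteq> {1..n}" "card A \<le> r * (k - 1)"
    and "n > r * (k - 1) + m * (r - 1)"
  shows "\<not> is_coloring (KG_avoid r A n k) m c"
proof
  assume c: "is_coloring (KG_avoid r A n k) m c"
  have thin: "S \<in> verts (KG_avoid r A n k)" if "thin_set {1..n} A (k - 1) k S" for S
  proof -
    have "\<not> S \<subseteq> A" using that \<open>k \<ge> 1\<close> by (auto simp: thin_set_def Int_absorb2)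
    then show ?thesis using that by (simp add: KG_avoid_verts thin_set_def)
  qed
  have "\<exists>v\<in>{1..m}. \<exists>E. mono_matching {1..n} A (k - 1) k c r v E"
    using assms c thin by (intro mono_matching_exists) (auto simp: is_coloring_def mult.commute)
  then obtain v E where E: "mono_matching {1..n} A (k - 1) k c r v E" by blast
  then have "E \<in> hyperedges (KG_avoid r A n k)"
    using thin by (auto simp: KG_avoid_hyperedges mono_matching_def)
  moreover have "monochromatic c E"
    using E by (auto simp: monochromatic_def mono_matching_def)
  ultimately show False using c by (auto simp: is_coloring_def)
qed

theorem theorem4p2:
  fixes r k n :: nat and A :: "nat set"
  assumes "r \<ge> 2" and "k \<ge> 1" and "n \<ge> 2 * r * k"
    and "A \<subseteq> {1..n}" and "card A \<le> b_num r * (k - 1)"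
  shows "int (chromatic_number (KG_avoid r A n k)) =
    \<lceil>(real n - real (max (r * (k - 1)) (card A))) / (real r - 1)\<rceil>"
proof -
  \<comment> \<open>This makes \<open>r * (k - 1)\<close> the maximum in the formula.\<close>
  have "b_num r * (k - 1) \<le> r * (k - 1)"
    using \<open>r \<ge> 2\<close> b_num_le[of r] by (intro mult_right_mono) simp_all
  then have A: "card A \<le> r * (k - 1)" using assms(5) by (rule order_trans[rotated])
  have "r * (k - 1) < 2 * r * k"
    using assms(1,2) by (cases k) (auto simp: algebra_simps)
  then have n: "r * (k - 1) < n" using assms(3) by (rule less_le_trans)
  define x where "x = (real n - real (r * (k - 1))) / (real r - 1)"
  have r1: "real r - 1 = real (r - 1)" "0 < real (r - 1)" using \<open>r \<ge> 2\<close> by simp_all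
  have "x > 0" using n r1 unfolding x_def by (intro divide_pos_pos) (simp_all del: of_nat_mult)
  \<comment> \<open>The ceiling is the least \<open>M\<close> with
    \<open>n \<le> r * (k - 1) + M * (r - 1)\<close>. It is at least 1 since \<open>x > 0\<close>,
    so \<open>M - 1\<close> below is an honest difference.\<close>
  define M where "M = nat \<lceil>x\<rceil>"
  have M: "int M = \<lceil>x\<rceil>" "M \<ge> 1" using \<open>x > 0\<close> by (simp_all add: M_def Suc_le_eq)
  have "x \<le> real M" "real M - 1 < x" using M(1) by linarith+
  then have "real n - real (r * (k - 1)) \<le> real M * real (r - 1)"
    "(real M - 1) * real (r - 1) < real n - real (r * (k - 1))"
    unfolding x_def r1(1) pos_divide_le_eq[OF r1(2)] pos_less_divide_eq[OF r1(2)] .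
  then have "real n \<le> real (r * (k - 1) + M * (r - 1))"
    "real (r * (k - 1) + (M - 1) * (r - 1)) < real n"
    unfolding of_nat_add of_nat_mult of_nat_diff[OF M(2)] of_nat_1 by linarith+
  then have upper: "n \<le> r * (k - 1) + M * (r - 1)" and lower: "r * (k - 1) + (M - 1) * (r - 1) < n"
    by (simp_all only: of_nat_le_iff of_nat_less_iff)
  have "chromatic_number (KG_avoid r A n k) = M"
    unfolding chromatic_number_def
  proof (rule Least_equality)
    show "\<exists>c. is_coloring (KG_avoid r A n k) M c"
      using KG_avoid_colorable[OF assms(1,2) M(2) upper] .
  next
    fix m assume "\<exists>c. is_coloring (KG_avoid r A n k) m c"
    then have "\<not> r * (k - 1) + m * (r - 1) < n"
      using KG_avoid_not_colorable[OF _ assms(2,4) A, of m] \<open>r \<ge> 2\<close> by auto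
    then have "(M - 1) * (r - 1) < m * (r - 1)" using lower by linarith
    then have "M - 1 < m" by simp
    then show "M \<le> m" by linarith
  qed
  then show ?thesis using M(1) by (simp only: max_absorb1[OF A] x_def)
qed

end
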